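(* Let $X=X(\Sigma)$ be a toric variety, let $\Psi$ be a choice of complements for $\Sigma$, let $D$ be a $\mathbb{Q}$-Cartier divisor on $X$ and $\sigma\in\Sigma$, and suppose that $D$ intersects $V(\sigma)$ properly. Then the $\mathbb{Q}$-Cartier divisor $D_\sigma$ on $V(\sigma)$ is the restriction of $D$ to $V(\sigma)$; consequently $D\cdot[V(\sigma)]$ is the cycle corresponding to the restriction of $D$ to $V(\sigma)$.
   Context: Setting. $N$ is a free abelian group of rank $n$, $M=\operatorname{Hom}(N,\mathbb{Z})$, $N_{\mathbb{Q}}=\mathbb{Q}\otimes N$, $M_{\mathbb{Q}}=\mathbb{Q}\otimes M$, $\Sigma$ is a fan of strongly convex rational polyhedral cones in $N_{\mathbb{Q}}$, and $X=X(\Sigma)$ is the associated toric variety over a fixed ground field. For cones, $\tau\succ\sigma$ means $\sigma$ is a proper face of $\tau$, and $\tau\to\sigma$ means $\sigma$ is a facet of $\tau$. For $\sigma\in\Sigma$, $N_\sigma$ is the subgroup of $N$ generated by $\sigma\cap N$, and $N(\sigma)=N/N_\sigma$. Write $M(\sigma)=\sigma^\perp\subset M_{\mathbb{Q}}$, $M_\tau=M_{\mathbb{Q}}/M(\tau)$, and for $\sigma\prec\tau$, $M(\sigma)_\tau=M(\sigma)/M(\tau)$, which is dual to $\mathbb{Q}\otimes(N_\tau/N_\sigma)$; $\langle\cdot,\cdot\rangle$ denotes the duality pairings. If $\tau\to\sigma$, $n_{\tau,\sigma}$ is the generator of $N_\tau/N_\sigma\cong\mathbb{Z}$ lying in the image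 of $\tau$. Cycles and divisors. For $\sigma\in\Sigma$ of dimension $n-k$, $V(\sigma)$ is the associated $k$-dimensional torus-invariant subvariety; it is the toric variety of the fan in $N(\sigma)$ consisting of the images of the cones $\tau\succeq\sigma$. An equivariant $\mathbb{Q}$-Cartier divisor $D$ on $X$ is a collection of local equations $m_\sigma\in M_\sigma$ ($\sigma\in\Sigma$) such that for $\tau\prec\sigma$ the natural map $M_\sigma\to M_\tau$ sends $m_\sigma$ to $m_\tau$ ($\chi^{m_\sigma}$ is a local equation for $D$ on $U_\sigma$). Similarly, a $\mathbb{Q}$-Cartier divisor on $V(\sigma)$ is a compatible collection of elements of $M(\sigma)_\tau$, $\tau\succeq\sigma$; the cycle corresponding to a $\mathbb{Q}$-Cartier divisor $E$ on $V(\sigma)$ with local equations $\bar m_\tau$ is $[E]=\sum_{\tau\to\sigma}\langle\bar m_\tau,n_{\tau,\sigma}\rangle[V(\tau)]$. The case $\sigma=0$ gives the cycle $[D]$ of a $\mathbb{Q}$-Cartier divisor $D$ on $X$. $D$ intersects $V(\sigma)$ properly if no codimension-one invariant subvariety containing $V(\sigma)$ occurs with non-zero coefficient in $[D]$; equivalently $m_\sigma=0$; equivalently $D$ restricts to a $\mathbb{Q}$-Cartier divisor on $V(\sigma)$. Choice of complements. $\Psi$ assigns to each $\sigma\in\Sigma$ a linear subspace $\Psi(\sigma)\subset M_{\mathbb{Q}}$ of dimension $\dim\sigma$ such that $\Psi(\sigma)\cap M(\sigma)=0$, and $\Psi(\tau)\subset\Psi(\sigma)$ whenever $\tau\prec\sigma$.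 Let $\pi_\sigma:M_{\mathbb{Q}}\to M(\sigma)$ be the projection along $\Psi(\sigma)$; for $\tau\succ\sigma$ it induces a map, also denoted $\pi_\sigma:M_\tau\to M(\sigma)_\tau$. Action. $D_\sigma$ is the $\mathbb{Q}$-Cartier divisor on $V(\sigma)$ with local equations $\pi_\sigma(m_\tau)\in M(\sigma)_\tau$, and $D\cdot[V(\sigma)]=[D_\sigma]=\sum_{\tau\to\sigma}\langle\pi_\sigma(m_\tau),n_{\tau,\sigma}\rangle[V(\tau)]$. *)

theory Defs
  imports Complex_Main "HOL-Library.FuncSet" "HOL-Library.Function_Algebras"
    "HOL-Library.Poly_Mapping"
begin

section \<open>Rational vector spaces\<close>

class rat_vector = ab_group_add +
  fixes scaleQ :: "rat \<Rightarrow> 'a \<Rightarrow> 'a" (infixr "*\<^sub>Q" 75)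
  assumes scaleQ_right_distrib: "a *\<^sub>Q (x + y) = a *\<^sub>Q x + a *\<^sub>Q y"
    and scaleQ_left_distrib: "(a + b) *\<^sub>Q x = a *\<^sub>Q x + b *\<^sub>Q x"
    and scaleQ_scaleQ: "a *\<^sub>Q (b *\<^sub>Q x) = (a * b) *\<^sub>Q x"
    and scaleQ_one: "1 *\<^sub>Q x = x"

interpretation qvec: vector_space "scaleQ :: rat \<Rightarrow> 'a \<Rightarrow> 'a::rat_vector"
  by unfold_locales (fact scaleQ_right_distrib scaleQ_left_distrib scaleQ_scaleQ scaleQ_one)+

instantiation rat :: rat_vector
begin
definition scaleQ_rat :: "rat \<Rightarrow> rat \<Rightarrow> rat" where "scaleQ_rat a x = a * x"
instance by standard (simp_all add: scaleQ_rat_def algebra_simps)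
end

instantiation "fun" :: (type, rat_vector) rat_vector
begin
definition scaleQ_fun :: "rat \<Rightarrow> ('a \<Rightarrow> 'b) \<Rightarrow> 'a \<Rightarrow> 'b" where
  "scaleQ_fun a f = (\<lambda>x. a *\<^sub>Q f x)"
instance
  by standard (simp_all add: scaleQ_fun_def fun_eq_iff scaleQ_right_distrib
      scaleQ_left_distrib scaleQ_scaleQ scaleQ_one)
end

section \<open>Lattices and quotients\<close>

text \<open>The type \<open>'v\<close> is \<open>N\<^sub>\<rat> = \<rat> \<otimes> N\<close>, in which a free abelian group \<open>N\<close> of rank \<open>n\<close> sits as
  the integer span of a basis. The space \<open>M\<^sub>\<rat> = \<rat> \<otimes> Hom(N, \<int>)\<close> is identified, as usual, with the
  space of linear forms on \<open>N\<^sub>\<rat>\<close>, so that the duality pairing is evaluation.\<close>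

definition free_lattice :: "'v::rat_vector set \<Rightarrow> nat \<Rightarrow> bool" where
  "free_lattice N n \<longleftrightarrow> (\<exists>B. finite B \<and> card B = n \<and> qvec.independent B \<and> qvec.span B = UNIV \<and>
     N = {\<Sum>b\<in>B. of_int (c b) *\<^sub>Q b | c :: 'v \<Rightarrow> int. True})"

definition MQ :: "('v::rat_vector \<Rightarrow> rat) set" where
  "MQ = {m. Vector_Spaces.linear scaleQ scaleQ m}"

text \<open>Elements of a quotient of abelian groups are cosets, that is, sets.\<close>

definition coset :: "'a::ab_group_add set \<Rightarrow> 'a \<Rightarrow> 'a set" where
  "coset W x = {x + w | w. w \<in> W}"

definition quot :: "'a::ab_group_add set \<Rightarrow> 'a set \<Rightarrow> 'a set set" where
  "quot V W = coset W ` V"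

text \<open>The natural map \<open>V/W \<rightarrow> V/W'\<close> for \<open>W \<subseteq> W'\<close>, applied to a coset \<open>A\<close> of \<open>W\<close>.\<close>

definition quot_map :: "'a::ab_group_add set \<Rightarrow> 'a set \<Rightarrow> 'a set" where
  "quot_map W' A = (\<Union>a\<in>A. coset W' a)"

definition subgrp :: "'a::ab_group_add set \<Rightarrow> bool" where
  "subgrp H \<longleftrightarrow> 0 \<in> H \<and> (\<forall>x\<in>H. \<forall>y\<in>H. x - y \<in> H)"

section \<open>Cones and fans\<close>

definition rational_polyhedral_cone :: "'v::rat_vector set \<Rightarrow> 'v set \<Rightarrow> bool" where
  "rational_polyhedral_cone N \<sigma> \<longleftrightarrow> (\<exists>S. finite S \<and> S \<subseteq> N \<and>
     \<sigma> = {\<Sum>v\<in>S. c v *\<^sub>Q v | c. \<forall>v\<in>S. 0 \<le> c v})"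

definition strongly_convex :: "'v::rat_vector set \<Rightarrow> bool" where
  "strongly_convex \<sigma> \<longleftrightarrow> \<sigma> \<inter> uminus ` \<sigma> = {0}"

definition face :: "'v::rat_vector set \<Rightarrow> 'v set \<Rightarrow> bool" where
  "face \<tau> \<sigma> \<longleftrightarrow> (\<exists>u\<in>MQ. (\<forall>x\<in>\<sigma>. 0 \<le> u x) \<and> \<tau> = {x \<in> \<sigma>. u x = 0})"

definition proper_face :: "'v::rat_vector set \<Rightarrow> 'v set \<Rightarrow> bool" where
  "proper_face \<tau> \<sigma> \<longleftrightarrow> face \<tau> \<sigma> \<and> \<tau> \<noteq> \<sigma>"

definition facet :: "'v::rat_vector set \<Rightarrow> 'v set \<Rightarrow> bool" where
  "facet \<sigma> \<tau> \<longleftrightarrow> face \<sigma> \<tau> \<and> qvec.dim \<tau> = qvec.dim \<sigma> + 1"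

definition fan :: "'v::rat_vector set \<Rightarrow> 'v set set \<Rightarrow> bool" where
  "fan N \<Delta> \<longleftrightarrow> finite \<Delta> \<and>
     (\<forall>\<sigma>\<in>\<Delta>. rational_polyhedral_cone N \<sigma> \<and> strongly_convex \<sigma>) \<and>
     (\<forall>\<sigma>\<in>\<Delta>. \<forall>\<tau>. face \<tau> \<sigma> \<longrightarrow> \<tau> \<in> \<Delta>) \<and>
     (\<forall>\<sigma>\<in>\<Delta>. \<forall>\<tau>\<in>\<Delta>. face (\<sigma> \<inter> \<tau>) \<sigma> \<and> face (\<sigma> \<inter> \<tau>) \<tau>)"

text \<open>The cones \<open>\<tau> \<succeq> \<sigma>\<close> of the fan; their images in \<open>N(\<sigma>)\<close> form the fan of \<open>V(\<sigma>)\<close>.\<close>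

definition star :: "'v::rat_vector set set \<Rightarrow> 'v set \<Rightarrow> 'v set set" where
  "star \<Delta> \<sigma> = {\<tau> \<in> \<Delta>. face \<sigma> \<tau>}"

text \<open>\<open>M(\<sigma>)\<close>\<close>

definition perp :: "'v::rat_vector set \<Rightarrow> ('v \<Rightarrow> rat) set" where
  "perp \<sigma> = {m \<in> MQ. \<forall>x\<in>\<sigma>. m x = 0}"

text \<open>\<open>N\<^sub>\<sigma>\<close>\<close>

definition cone_lattice :: "'v::rat_vector set \<Rightarrow> 'v set \<Rightarrow> 'v set" where
  "cone_lattice N \<sigma> = subgrp hull (\<sigma> \<inter> N)"

text \<open>\<open>n\<^bsub>\<tau>,\<sigma>\<^esub>\<close>, a coset of \<open>N\<^sub>\<sigma>\<close> in \<open>N\<^sub>\<tau>\<close>; it is unique when \<open>\<sigma>\<close> is a facet of the strongly convex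
  cone \<open>\<tau>\<close>.\<close>

definition normal_gen :: "'v::rat_vector set \<Rightarrow> 'v set \<Rightarrow> 'v set \<Rightarrow> 'v set" where
  "normal_gen N \<tau> \<sigma> = (THE C. \<exists>x \<in> \<tau> \<inter> N. C = coset (cone_lattice N \<sigma>) x \<and>
     (\<forall>y \<in> cone_lattice N \<tau>. \<exists>k::int. y - of_int k *\<^sub>Q x \<in> cone_lattice N \<sigma>))"

text \<open>The pairing of \<open>M(\<sigma>)\<^sub>\<tau>\<close> with \<open>N\<^sub>\<tau>/N\<^sub>\<sigma>\<close>: the common value of all representatives.\<close>

definition pairing :: "('v \<Rightarrow> rat) set \<Rightarrow> 'v set \<Rightarrow> rat" where
  "pairing A C = (THE r. \<forall>m\<in>A. \<forall>x\<in>C. m x = r)"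

section \<open>Divisors and cycles\<close>

definition q_cartier :: "'v::rat_vector set set \<Rightarrow> ('v set \<Rightarrow> ('v \<Rightarrow> rat) set) set" where
  "q_cartier \<Delta> = {m \<in> (\<Pi>\<^sub>E \<sigma>\<in>\<Delta>. quot MQ (perp \<sigma>)).
     \<forall>\<sigma>\<in>\<Delta>. \<forall>\<tau>\<in>\<Delta>. proper_face \<tau> \<sigma> \<longrightarrow> quot_map (perp \<tau>) (m \<sigma>) = m \<tau>}"

text \<open>Divisors on \<open>V(\<sigma>)\<close>. As sets of cosets, \<open>M(\<sigma>)\<^sub>\<tau> = M(\<sigma>)/M(\<tau>)\<close> is literally contained in
  \<open>M\<^sub>\<tau> = M\<^sub>\<rat>/M(\<tau>)\<close>.\<close>

definition q_cartier_on ::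
  "'v::rat_vector set set \<Rightarrow> 'v set \<Rightarrow> ('v set \<Rightarrow> ('v \<Rightarrow> rat) set) set" where
  "q_cartier_on \<Delta> \<sigma> = {m \<in> (\<Pi>\<^sub>E \<tau>\<in>star \<Delta> \<sigma>. quot (perp \<sigma>) (perp \<tau>)).
     \<forall>\<tau>\<in>star \<Delta> \<sigma>. \<forall>\<tau>'\<in>star \<Delta> \<sigma>. proper_face \<tau>' \<tau> \<longrightarrow> quot_map (perp \<tau>') (m \<tau>) = m \<tau>'}"

text \<open>Invariant cycles with rational coefficients are formal combinations of cones, the cone \<open>\<tau>\<close>
  standing for \<open>[V(\<tau>)]\<close>.\<close>

definition cycle_on :: "'v::rat_vector set \<Rightarrow> 'v set set \<Rightarrow> 'v set \<Rightarrow>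
    ('v set \<Rightarrow> ('v \<Rightarrow> rat) set) \<Rightarrow> 'v set \<Rightarrow>\<^sub>0 rat" where
  "cycle_on N \<Delta> \<sigma> E =
     (\<Sum>\<tau> | \<tau> \<in> \<Delta> \<and> facet \<sigma> \<tau>. Poly_Mapping.single \<tau> (pairing (E \<tau>) (normal_gen N \<tau> \<sigma>)))"

text \<open>The codimension-one invariant subvarieties are the \<open>V(\<rho>)\<close> with \<open>\<rho>\<close> a ray, and
  \<open>V(\<sigma>) \<subseteq> V(\<rho>)\<close> iff \<open>\<rho>\<close> is a face of \<open>\<sigma>\<close>.\<close>

definition meets_properly :: "'v::rat_vector set \<Rightarrow> 'v set set \<Rightarrow>
    ('v set \<Rightarrow> ('v \<Rightarrow> rat) set) \<Rightarrow> 'v set \<Rightarrow> bool" where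
  "meets_properly N \<Delta> D \<sigma> \<longleftrightarrow> (\<forall>\<rho>\<in>\<Delta>. qvec.dim \<rho> = 1 \<and> face \<rho> \<sigma> \<longrightarrow>
     Poly_Mapping.lookup (cycle_on N \<Delta> {0} D) \<rho> = 0)"

text \<open>The rational function \<open>\<chi>\<^sup>m\<close> has neither zero nor pole along \<open>V(\<sigma>)\<close> precisely when
  \<open>m \<in> M(\<sigma>)\<close>, and it then restricts to the character \<open>m\<close> of the torus of \<open>V(\<sigma>)\<close>. Hence a local
  equation of the restriction near \<open>\<tau> \<succeq> \<sigma>\<close> is a representative of \<open>m\<^sub>\<tau>\<close> in \<open>M(\<sigma>)\<close>; these
  representatives form an element of \<open>M(\<sigma>)/M(\<tau>)\<close> or the empty set, so \<open>D\<close> restricts to a divisor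
  on \<open>V(\<sigma>)\<close> iff the collection below lies in \<open>q_cartier_on \<Delta> \<sigma>\<close>.\<close>

definition restriction :: "'v::rat_vector set set \<Rightarrow> ('v set \<Rightarrow> ('v \<Rightarrow> rat) set) \<Rightarrow>
    'v set \<Rightarrow> 'v set \<Rightarrow> ('v \<Rightarrow> rat) set" where
  "restriction \<Delta> D \<sigma> = (\<lambda>\<tau>\<in>star \<Delta> \<sigma>. D \<tau> \<inter> perp \<sigma>)"

section \<open>Complements and the action of divisors on cycles\<close>

definition complements :: "'v::rat_vector set set \<Rightarrow> ('v set \<Rightarrow> ('v \<Rightarrow> rat) set) \<Rightarrow> bool" where
  "complements \<Delta> \<Psi> \<longleftrightarrow>
     (\<forall>\<sigma>\<in>\<Delta>. \<Psi> \<sigma> \<subseteq> MQ \<and> qvec.subspace (\<Psi> \<sigma>) \<and> qvec.dim (\<Psi> \<sigma>) = qvec.dim \<sigma> \<and>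
        \<Psi> \<sigma> \<inter> perp \<sigma> = {0}) \<and>
     (\<forall>\<sigma>\<in>\<Delta>. \<forall>\<tau>\<in>\<Delta>. proper_face \<tau> \<sigma> \<longrightarrow> \<Psi> \<tau> \<subseteq> \<Psi> \<sigma>)"

definition proj :: "('v::rat_vector set \<Rightarrow> ('v \<Rightarrow> rat) set) \<Rightarrow> 'v set \<Rightarrow>
    ('v \<Rightarrow> rat) \<Rightarrow> 'v \<Rightarrow> rat" where
  "proj \<Psi> \<sigma> m = (THE p. p \<in> perp \<sigma> \<and> m - p \<in> \<Psi> \<sigma>)"

text \<open>\<open>D\<^sub>\<sigma>\<close>. Since the projection fixes \<open>M(\<tau>) \<subseteq> M(\<sigma>)\<close> pointwise, the induced map
  \<open>M\<^sub>\<tau> \<rightarrow> M(\<sigma>)\<^sub>\<tau>\<close> sends a coset to its image.\<close>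

definition proj_divisor :: "'v::rat_vector set set \<Rightarrow> ('v set \<Rightarrow> ('v \<Rightarrow> rat) set) \<Rightarrow>
    ('v set \<Rightarrow> ('v \<Rightarrow> rat) set) \<Rightarrow> 'v set \<Rightarrow> 'v set \<Rightarrow> ('v \<Rightarrow> rat) set" where
  "proj_divisor \<Delta> \<Psi> D \<sigma> = (\<lambda>\<tau>\<in>star \<Delta> \<sigma>. proj \<Psi> \<sigma> ` D \<tau>)"

text \<open>\<open>D \<cdot> [V(\<sigma>)]\<close>\<close>

definition intersect :: "'v::rat_vector set \<Rightarrow> 'v set set \<Rightarrow> ('v set \<Rightarrow> ('v \<Rightarrow> rat) set) \<Rightarrow>
    ('v set \<Rightarrow> ('v \<Rightarrow> rat) set) \<Rightarrow> 'v set \<Rightarrow> 'v set \<Rightarrow>\<^sub>0 rat" where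
  "intersect N \<Delta> \<Psi> D \<sigma> = cycle_on N \<Delta> \<sigma> (proj_divisor \<Delta> \<Psi> D \<sigma>)"

end

theory Submission
  imports Defs
begin

text \<open>Meeting properly says that the local equation \<open>m\<close> of \<open>D\<close> at \<open>\<sigma>\<close> vanishes on the primitive
  generators of the rays of \<open>\<sigma>\<close>. A strongly convex polyhedral cone is generated by its rays, so
  \<open>m\<^sub>\<sigma> = 0\<close>. By compatibility every \<open>m\<^sub>\<tau>\<close> with \<open>\<tau> \<succeq> \<sigma>\<close> then lies in \<open>M(\<sigma>)/M(\<tau>)\<close>, where the
  projection along \<open>\<Psi>(\<sigma>)\<close> is the identity. That the elements of a minimal generating set span
  rays (one-dimensional faces) rests on Gordan's theorem of the alternative.\<close>

section \<open>Linear forms\<close>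

interpretation qform: vector_space_pair "scaleQ :: rat \<Rightarrow> 'a \<Rightarrow> 'a::rat_vector"
  "scaleQ :: rat \<Rightarrow> rat \<Rightarrow> rat" ..

lemma MQ_linear: "m \<in> MQ \<longleftrightarrow> Vector_Spaces.linear scaleQ scaleQ m"
  by (simp add: MQ_def)

lemma MQ_zero [simp]: "u \<in> MQ \<Longrightarrow> u 0 = 0"
  unfolding MQ_linear by (rule qform.linear_0)

lemma MQ_minus: "u \<in> MQ \<Longrightarrow> u (x - y) = u x - u y"
  unfolding MQ_linear by (rule qform.linear_diff)

lemma MQ_scale: "u \<in> MQ \<Longrightarrow> u (a *\<^sub>Q x) = a * u x"
  unfolding MQ_linear by (simp add: qform.linear_scale scaleQ_rat_def)

lemma MQ_sum: "u \<in> MQ \<Longrightarrow> u (\<Sum>x\<in>S. c x *\<^sub>Q x) = (\<Sum>x\<in>S. c x * u x)"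
  unfolding MQ_linear
  by (simp add: qform.linear_sum qform.linear_scale scaleQ_rat_def)

lemma zero_in_MQ: "(\<lambda>_. 0) \<in> MQ"
  unfolding MQ_linear by (rule qform.linear_zero)

lemma MQ_add: "u \<in> MQ \<Longrightarrow> v \<in> MQ \<Longrightarrow> (\<lambda>x. u x + v x) \<in> MQ"
  unfolding MQ_linear by (rule qform.linear_compose_add)

lemma MQ_scaled: "u \<in> MQ \<Longrightarrow> (\<lambda>x. a * u x) \<in> MQ"
  unfolding MQ_linear using qform.linear_compose_scale_right[of u a]
  by (simp add: scaleQ_rat_def)

text \<open>A basis of the span of \<open>W\<close> stays independent after adding \<open>t\<close>,
  and values of a form can be prescribed freely on an independent set.\<close>

lemma form_separating_point:
  assumes "t \<notin> qvec.span W"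
  obtains f where "f \<in> MQ" "\<And>w. w \<in> qvec.span W \<Longrightarrow> f w = 0" "f t = 1"
proof -
  obtain B where B: "B \<subseteq> W" "qvec.independent B" "W \<subseteq> qvec.span B"
    by (metis qvec.maximal_independent_subset)
  have span: "qvec.span B = qvec.span W"
    using B by (metis qvec.span_mono qvec.span_span subset_antisym)
  have "qvec.independent (insert t B)"
    using B assms span by (simp add: qvec.independent_insert)
  then obtain f where f: "Vector_Spaces.linear scaleQ scaleQ f"
      "\<forall>x\<in>insert t B. f x = (if x = t then 1 else 0 :: rat)"
    using qform.linear_independent_extend[of "insert t B" "\<lambda>x. if x = t then 1 else 0"] by blast
  have "\<And>b. b \<in> B \<Longrightarrow> f b = 0"
    using f(2) assms span by (metis insertCI qvec.span_base)
  then have "\<And>w. w \<in> qvec.span W \<Longrightarrow> f w = 0"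
    using qform.linear_eq_0_on_span[OF f(1)] span by blast
  with f that show thesis by (auto simp: MQ_linear)
qed

section \<open>Polyhedral cones\<close>

text \<open>Gordan's alternative relative to a subspace. Keeping \<open>W\<close> arbitrary drives
  the induction, because a new vector \<open>t\<close> can be moved from \<open>T\<close> into
  \<open>W\<close>. Taken with \<open>W\<close> a single generator, it yields a form supporting a
  cone exactly along a ray.\<close>

lemma gordan:
  fixes T W :: "'v::rat_vector set"
  assumes "finite T"
    and "\<And>c. (\<And>t. t \<in> T \<Longrightarrow> 0 \<le> c t) \<Longrightarrow> (\<Sum>t\<in>T. c t *\<^sub>Q t) \<in> qvec.span W \<Longrightarrow> \<forall>t\<in>T. c t = 0"
  shows "\<exists>u\<in>MQ. (\<forall>w\<in>qvec.span W. u w = 0) \<and> (\<forall>t\<in>T. 0 < u t)"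
  using assms
proof (induction T arbitrary: W rule: finite_induct)
  case empty
  then show ?case using zero_in_MQ by auto
next
  case (insert t T)
  have sum_upd: "(\<Sum>s\<in>insert t T. (c(t := a)) s *\<^sub>Q s) = a *\<^sub>Q t + (\<Sum>s\<in>T. c s *\<^sub>Q s)" for c a
    using insert.hyps by (simp, intro sum.cong) auto
  \<comment> \<open>The hypothesis on \<open>insert t T\<close>, with the coefficient of
    \<open>t\<close> split off as \<open>a\<close>.\<close>
  have comb: "a = 0 \<and> (\<forall>s\<in>T. c s = 0)"
    if "\<And>s. s \<in> T \<Longrightarrow> 0 \<le> c s" "0 \<le> a" "a *\<^sub>Q t + (\<Sum>s\<in>T. c s *\<^sub>Q s) \<in> qvec.span W" for c a
  proof -
    have "\<forall>s\<in>insert t T. (c(t := a)) s = 0"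
      using that by (intro insert.prems) (auto simp only: sum_upd, auto)
    with insert.hyps show ?thesis by (metis fun_upd_apply insertCI)
  qed
  have T: "\<forall>s\<in>T. c s = 0"
    if "\<And>s. s \<in> T \<Longrightarrow> 0 \<le> c s" "(\<Sum>s\<in>T. c s *\<^sub>Q s) \<in> qvec.span W" for c
    using comb[of c 0] that by simp
  obtain u where u: "u \<in> MQ" "\<forall>w\<in>qvec.span W. u w = 0" "\<forall>s\<in>T. 0 < u s"
    using insert.IH[of W] T by blast
  show ?case
  proof (cases "\<forall>c. (\<forall>s\<in>T. 0 \<le> c s) \<longrightarrow> (\<Sum>s\<in>T. c s *\<^sub>Q s) \<in> qvec.span (insert t W) \<longrightarrow>
      (\<forall>s\<in>T. c s = 0)")
    \<comment> \<open>The hypothesis survives passing to the quotient by \<open>t\<close>, so there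
      is a form \<open>u'\<close> vanishing at \<open>t\<close> and positive on \<open>T\<close>. A
      form \<open>f\<close> with value 1 at \<open>t\<close> is corrected on \<open>T\<close> by a
      large multiple of \<open>u'\<close>, which leaves its value at \<open>t\<close>
      unchanged.\<close>
    case True
    then obtain u' where u': "u' \<in> MQ" "\<forall>w\<in>qvec.span (insert t W). u' w = 0" "\<forall>s\<in>T. 0 < u' s"
      using insert.IH[of "insert t W"] by blast
    have "t \<notin> qvec.span W"
      using comb[of "\<lambda>_. 0" 1] by auto
    then obtain f where f: "f \<in> MQ" "\<And>w. w \<in> qvec.span W \<Longrightarrow> f w = 0" "f t = 1"
      by (rule form_separating_point) blast
    \<comment> \<open>Each ratio is at most the sum; the extra 1 makes the bound strict, so
      \<open>e * u' s\<close> exceeds the absolute value of \<open>f s\<close>.\<close>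
    define e where "e = 1 + (\<Sum>s\<in>T. \<bar>f s\<bar> / u' s)"
    have e: "f s + e * u' s > 0" if "s \<in> T" for s
    proof -
      have "\<bar>f s\<bar> / u' s \<le> (\<Sum>s\<in>T. \<bar>f s\<bar> / u' s)"
        using u'(3) that insert.hyps by (intro member_le_sum) (auto simp: less_imp_le)
      then have "\<bar>f s\<bar> / u' s < e" by (simp add: e_def)
      then have "\<bar>f s\<bar> < e * u' s" using u'(3) that by (simp add: divide_less_eq)
      then show ?thesis by linarith
    qed
    have "u' t = 0" "\<And>w. w \<in> qvec.span W \<Longrightarrow> u' w = 0"
      using u'(2) qvec.span_mono[of W "insert t W"] by (auto simp: qvec.span_base)
    then show ?thesis
      using e f by (intro bexI[of _ "\<lambda>x. f x + e * u' x"] MQ_add MQ_scaled u' f) auto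
  next
    case False
    \<comment> \<open>Here a nontrivial nonnegative combination of \<open>T\<close> equals a
      multiple of \<open>t\<close> modulo the span of \<open>W\<close>. The multiple
      \<open>a\<close> must be positive, since otherwise moving it across gives a forbidden
      relation. Hence the form \<open>u\<close> found for \<open>T\<close> is automatically positive
      at \<open>t\<close>.\<close>
    then obtain c s0 a where c: "\<forall>s\<in>T. 0 \<le> c s" "s0 \<in> T" "c s0 \<noteq> 0"
        and a: "(\<Sum>s\<in>T. c s *\<^sub>Q s) - a *\<^sub>Q t \<in> qvec.span W"
      by (auto simp: qvec.span_insert)
    have "a > 0"
    proof (rule ccontr)
      assume "\<not> a > 0"
      then show False using comb[of c "- a"] c a by (auto simp: algebra_simps)
    qed
    have "u ((\<Sum>s\<in>T. c s *\<^sub>Q s) - a *\<^sub>Q t) = 0" using u a by blast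
    then have "a * u t = (\<Sum>s\<in>T. c s * u s)"
      using u(1) by (simp add: MQ_minus MQ_sum MQ_scale)
    also have "\<dots> > 0"
    proof (rule sum_pos2[OF insert.hyps(1) c(2)])
      show "0 < c s0 * u s0" using c u by (simp add: less_le)
      show "\<And>s. s \<in> T \<Longrightarrow> 0 \<le> c s * u s" using c u by (simp add: less_imp_le)
    qed
    finally have "0 < u t" using \<open>a > 0\<close> by (simp add: zero_less_mult_iff)
    with u show ?thesis by blast
  qed
qed

section \<open>Minimal generators and extremal rays of a cone\<close>

definition cone_hull :: "'v::rat_vector set \<Rightarrow> 'v set" where
  "cone_hull S = {\<Sum>v\<in>S. c v *\<^sub>Q v | c. \<forall>v\<in>S. 0 \<le> c v}"

lemma cone_hullI: "\<forall>v\<in>S. 0 \<le> c v \<Longrightarrow> (\<Sum>v\<in>S. c v *\<^sub>Q v) \<in> cone_hull S"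
  by (auto simp: cone_hull_def)

lemma cone_hull_base:
  assumes "finite S" "v \<in> S" "0 \<le> a"
  shows "a *\<^sub>Q v \<in> cone_hull S"
proof -
  have "(\<Sum>w\<in>S. (if w = v then a else 0) *\<^sub>Q w) = a *\<^sub>Q v"
    using assms by (simp add: if_distrib[of "\<lambda>c. c *\<^sub>Q _"] cong: if_cong)
  then show ?thesis using cone_hullI[of S "\<lambda>w. if w = v then a else 0"] assms by simp
qed

text \<open>A redundant generator is eliminated by substituting its expression in the others;
  nonnegativity of all coefficients is preserved.\<close>

lemma cone_hull_remove:
  assumes "finite S" "v \<in> S" "v \<in> cone_hull (S - {v})"
  shows "cone_hull (S - {v}) = cone_hull S"
proof
  obtain d where d: "v = (\<Sum>w\<in>S - {v}. d w *\<^sub>Q w)" "\<forall>w\<in>S - {v}. 0 \<le> d w"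
    using assms(3) by (auto simp: cone_hull_def)
  show "cone_hull (S - {v}) \<subseteq> cone_hull S"
  proof
    fix x assume "x \<in> cone_hull (S - {v})"
    then obtain c where c: "x = (\<Sum>w\<in>S - {v}. c w *\<^sub>Q w)" "\<forall>w\<in>S - {v}. 0 \<le> c w"
      by (auto simp: cone_hull_def)
    have "x = (\<Sum>w\<in>S. (c(v := 0)) w *\<^sub>Q w)"
      unfolding c(1) using assms(1,2) by (simp add: sum.remove[of S v])
    then show "x \<in> cone_hull S" using cone_hullI[of S "c(v := 0)"] c(2) by auto
  qed
  show "cone_hull S \<subseteq> cone_hull (S - {v})"
  proof
    fix x assume "x \<in> cone_hull S"
    then obtain c where c: "x = (\<Sum>w\<in>S. c w *\<^sub>Q w)" "\<forall>w\<in>S. 0 \<le> c w"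
      by (auto simp: cone_hull_def)
    have "x = c v *\<^sub>Q v + (\<Sum>w\<in>S - {v}. c w *\<^sub>Q w)"
      unfolding c(1) using assms(1,2) by (simp add: sum.remove[of S v])
    also have "c v *\<^sub>Q v = (\<Sum>w\<in>S - {v}. (c v * d w) *\<^sub>Q w)"
      by (subst d(1)) (simp add: qvec.scale_sum_right)
    finally have "x = (\<Sum>w\<in>S - {v}. (c v * d w + c w) *\<^sub>Q w)"
      by (simp add: scaleQ_left_distrib sum.distrib)
    then show "x \<in> cone_hull (S - {v})"
      using cone_hullI[of "S - {v}" "\<lambda>w. c v * d w + c w"] c d assms by auto
  qed
qed

lemma minimal_generators:
  assumes "rational_polyhedral_cone N \<sigma>"
  obtains S where "finite S" "S \<subseteq> N" "\<sigma> = cone_hull S" "\<And>v. v \<in> S \<Longrightarrow> v \<notin> cone_hull (S - {v})"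
proof -
  define P where "P S \<longleftrightarrow> finite S \<and> S \<subseteq> N \<and> \<sigma> = cone_hull S" for S
  have "\<exists>S. P S" using assms by (auto simp: rational_polyhedral_cone_def P_def cone_hull_def)
  \<comment> \<open>A generating set of least cardinality has no redundant element, as deleting one
    would give a smaller generating set.\<close>
  then obtain S where S: "P S" "\<And>T. P T \<Longrightarrow> card S \<le> card T"
    using ex_has_least_nat[of P _ card] by blast
  have "v \<notin> cone_hull (S - {v})" if "v \<in> S" for v
  proof
    assume "v \<in> cone_hull (S - {v})"
    with that S(1) have "P (S - {v})" using cone_hull_remove[of S v] by (auto simp: P_def)
    then have "card S \<le> card (S - {v})" by (rule S(2))
    with that S(1) show False
      by (metis P_def card_Diff1_less linorder_not_less)
  qed
  with S(1) that show thesis by (auto simp: P_def)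
qed

text \<open>In a relation with sum zero, the negative of one term is the sum of the remaining ones.
  So the term and its negative both lie in the cone, which forces the term to vanish.\<close>

lemma strongly_convex_no_relation:
  assumes "finite S" "strongly_convex (cone_hull S)" "0 \<notin> S"
    and c: "\<forall>v\<in>S. 0 \<le> c v" "(\<Sum>v\<in>S. c v *\<^sub>Q v) = 0" and "v \<in> S"
  shows "c v = 0"
proof -
  have "(\<Sum>w\<in>S. (c(v := 0)) w *\<^sub>Q w) = - (c v *\<^sub>Q v)"
    using c(2) assms by (simp add: sum.remove[of S v] eq_neg_iff_add_eq_0 add.commute)
  then have "- (c v *\<^sub>Q v) \<in> cone_hull S"
    using cone_hullI[of S "c(v := 0)"] c(1) by simp
  moreover have "c v *\<^sub>Q v \<in> cone_hull S"
    using assms by (intro cone_hull_base) auto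
  ultimately have "c v *\<^sub>Q v \<in> cone_hull S \<inter> uminus ` cone_hull S"
    by (metis IntI image_eqI minus_minus)
  then have "c v *\<^sub>Q v = 0" using assms(2) unfolding strongly_convex_def by blast
  with assms show ?thesis by (metis qvec.scale_eq_0_iff)
qed

text \<open>Gordan's theorem modulo the line of \<open>v\<close> supplies a form that is zero at
  \<open>v\<close> and positive at all other generators; it cuts out the ray of
  \<open>v\<close>.\<close>

lemma face_minimal_generator:
  assumes S: "finite S" and sc: "strongly_convex (cone_hull S)"
    and minimal: "\<And>v. v \<in> S \<Longrightarrow> v \<notin> cone_hull (S - {v})" and v: "v \<in> S"
  shows "v \<noteq> 0" and "face {a *\<^sub>Q v | a. 0 \<le> a} (cone_hull S)"
proof -
  \<comment> \<open>Zero lies in every cone, so it is always a redundant generator.\<close>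
  have zero: "0 \<notin> S"
    using minimal[of 0] cone_hullI[of "S - {0}" "\<lambda>_. 0"] by auto
  then show "v \<noteq> 0" using v by blast
  have S_v: "(\<Sum>w\<in>S. c w *\<^sub>Q w) = c v *\<^sub>Q v + (\<Sum>w\<in>S - {v}. c w *\<^sub>Q w)" for c
    using S v by (simp add: sum.remove[of S v])
  have "\<exists>u\<in>MQ. (\<forall>w\<in>qvec.span {v}. u w = 0) \<and> (\<forall>t\<in>S - {v}. 0 < u t)"
  proof (rule gordan)
    show "finite (S - {v})" using S by simp
    fix c assume c: "\<And>t. t \<in> S - {v} \<Longrightarrow> 0 \<le> c t"
      and span: "(\<Sum>t\<in>S - {v}. c t *\<^sub>Q t) \<in> qvec.span {v}"
    obtain a where a: "(\<Sum>t\<in>S - {v}. c t *\<^sub>Q t) = a *\<^sub>Q v"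
      using span by (auto simp: qvec.span_singleton)
    show "\<forall>t\<in>S - {v}. c t = 0"
    \<comment> \<open>If \<open>a\<close> is positive, dividing by it expresses \<open>v\<close>
      through the other generators, against minimality. Otherwise \<open>- a\<close> is a
      nonnegative coefficient for \<open>v\<close>, and strong convexity kills the resulting
      relation.\<close>
    proof (cases "a > 0")
      case True
      have "v = inverse a *\<^sub>Q a *\<^sub>Q v" using True by simp
      also have "\<dots> = (\<Sum>t\<in>S - {v}. (inverse a * c t) *\<^sub>Q t)"
        by (simp flip: a add: qvec.scale_sum_right)
      finally have "v \<in> cone_hull (S - {v})"
        using cone_hullI[of "S - {v}" "\<lambda>t. inverse a * c t"] True c by auto
      with minimal v show ?thesis by blast
    next
      case False
      define d where "d = c(v := - a)"
      have "(\<Sum>w\<in>S. d w *\<^sub>Q w) = 0"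
        using a by (simp add: S_v d_def)
      moreover have "\<forall>w\<in>S. 0 \<le> d w" using c False by (simp add: d_def)
      ultimately have "d t = 0" if "t \<in> S" for t
        using strongly_convex_no_relation[OF S sc zero] that by blast
      then show ?thesis by (metis DiffD1 DiffD2 d_def fun_upd_other singletonI)
    qed
  qed
  then obtain u where u: "u \<in> MQ" "\<forall>w\<in>qvec.span {v}. u w = 0" "\<forall>t\<in>S - {v}. 0 < u t"
    by blast
  have uv: "u v = 0" using u(2) qvec.span_base by blast
  have nonneg: "0 \<le> u t" if "t \<in> S" for t
    using u(3) uv that by (cases "t = v") (auto simp: less_imp_le)
  show "face {a *\<^sub>Q v | a. 0 \<le> a} (cone_hull S)"
    unfolding face_def
  proof (intro bexI[of _ u] conjI ballI set_eqI iffI)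
    fix x assume "x \<in> cone_hull S"
    then show "0 \<le> u x"
      using nonneg u(1) by (auto simp: cone_hull_def MQ_sum intro!: sum_nonneg)
  next
    fix x assume "x \<in> {a *\<^sub>Q v | a. 0 \<le> a}"
    then show "x \<in> {x \<in> cone_hull S. u x = 0}"
      using S v u(1) uv by (auto simp: MQ_scale cone_hull_base)
  next
    fix x assume "x \<in> {x \<in> cone_hull S. u x = 0}"
    then obtain c where c: "x = (\<Sum>w\<in>S. c w *\<^sub>Q w)" "\<forall>w\<in>S. 0 \<le> c w" "u x = 0"
      by (auto simp: cone_hull_def)
    have "(\<Sum>w\<in>S. c w * u w) = 0" using c u(1) by (simp add: MQ_sum)
    \<comment> \<open>A vanishing sum of nonnegative terms; positivity of \<open>u\<close> away from
      \<open>v\<close> then leaves only the coefficient of \<open>v\<close>.\<close>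
    then have "\<forall>w\<in>S. c w * u w = 0"
      using S c nonneg by (subst (asm) sum_nonneg_eq_0_iff) auto
    then have "\<forall>w\<in>S - {v}. c w = 0" using u(3) by force
    then have "x = c v *\<^sub>Q v" using c(1) S_v by (simp add: sum.neutral)
    then show "x \<in> {a *\<^sub>Q v | a. 0 \<le> a}" using c v by auto
  qed (rule u(1))
qed

lemma dim_ray:
  assumes "v \<noteq> 0"
  shows "qvec.dim {a *\<^sub>Q v | a. 0 \<le> a} = 1"
proof (rule qvec.dim_unique[of "{v}"])
  have "v = 1 *\<^sub>Q v" by simp
  then show "{v} \<subseteq> {a *\<^sub>Q v | a. 0 \<le> a}" using zero_le_one by blast
  show "{a *\<^sub>Q v | a. 0 \<le> a} \<subseteq> qvec.span {v}" by (auto simp: qvec.span_singleton)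
  show "qvec.independent {v}" using assms by simp
qed simp

section \<open>Lattices and primitive generators of rays\<close>

lemma subgrp_minus: "subgrp H \<Longrightarrow> x \<in> H \<Longrightarrow> y \<in> H \<Longrightarrow> x - y \<in> H"
  by (simp add: subgrp_def)

lemma subgrp_int_scale:
  fixes x :: "'v::rat_vector"
  assumes "subgrp H" "x \<in> H"
  shows "of_int k *\<^sub>Q x \<in> H"
proof -
  have minus: "- y \<in> H" if "y \<in> H" for y
    using assms that subgrp_minus[of H 0 y] by (simp add: subgrp_def)
  have nat: "of_nat j *\<^sub>Q x \<in> H" for j
  proof (induction j)
    case 0
    then show ?case using assms by (simp add: subgrp_def)
  next
    case (Suc j)
    have "of_nat (Suc j) *\<^sub>Q x = of_nat j *\<^sub>Q x - (- x)"
      by (simp add: scaleQ_left_distrib add.commute)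
    also have "\<dots> \<in> H" using Suc minus assms by (intro subgrp_minus)
    finally show ?case .
  qed
  show ?thesis
  proof (cases k)
    case (nonneg j)
    then show ?thesis using nat by simp
  next
    case (neg j)
    then have "of_int k *\<^sub>Q x = - (of_nat (Suc j) *\<^sub>Q x)"
      by (simp only: of_int_minus of_int_of_nat_eq qvec.scale_minus_left)
    with nat[of "Suc j"] minus show ?thesis by metis
  qed
qed

lemma free_lattice_subgrp:
  assumes "free_lattice N n"
  shows "subgrp N"
proof -
  obtain B :: "'a set" where
    N: "N = {\<Sum>b\<in>B. of_int (c b) *\<^sub>Q b | c :: 'a \<Rightarrow> int. True}"
    using assms by (auto simp: free_lattice_def)
  have "0 \<in> N" unfolding N by (intro CollectI exI[of _ "\<lambda>_. 0"]) simp
  moreover have "(\<Sum>b\<in>B. of_int (c b) *\<^sub>Q b) - (\<Sum>b\<in>B. of_int (d b) *\<^sub>Q b) \<in> N" for c d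
    unfolding N by (intro CollectI exI[of _ "\<lambda>b. c b - d b"])
      (simp add: qvec.scale_left_diff_distrib sum_subtractf)
  ultimately show ?thesis unfolding subgrp_def by (auto simp: N)
qed

text \<open>The form is a coordinate in which \<open>v\<close> is nonzero, with its sign adjusted.
  Its integrality on \<open>N\<close> lets lattice points on the ray of \<open>v\<close> be compared
  by integers, so that a shortest one exists.\<close>

lemma free_lattice_integral_form:
  assumes "free_lattice N n" "v \<in> N" "v \<noteq> 0"
  obtains \<phi> where "\<phi> \<in> MQ" "\<And>x. x \<in> N \<Longrightarrow> \<phi> x \<in> \<int>" "0 < \<phi> v"
proof -
  obtain B where B: "finite B" "qvec.independent B"
    and N: "N = {\<Sum>b\<in>B. of_int (c b) *\<^sub>Q b | c :: 'a \<Rightarrow> int. True}"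
    using assms by (auto simp: free_lattice_def)
  obtain c :: "'a \<Rightarrow> int" where c: "v = (\<Sum>b\<in>B. of_int (c b) *\<^sub>Q b)"
    using assms(2) N by auto
  obtain b0 where b0: "b0 \<in> B" "c b0 \<noteq> 0"
  proof (rule ccontr)
    assume "\<not> thesis"
    with that have "\<forall>b\<in>B. c b = 0" by blast
    with c assms(3) show False by simp
  qed
  obtain f where f: "f \<in> MQ" "\<forall>b\<in>B. f b = (if b = b0 then 1 else 0)"
    unfolding MQ_linear
    using qform.linear_independent_extend[OF B(2), of "\<lambda>b. if b = b0 then 1 else 0"] by blast
  have coord: "f (\<Sum>b\<in>B. of_int (d b) *\<^sub>Q b) = of_int (d b0)" for d
  proof -
    have "f (\<Sum>b\<in>B. of_int (d b) *\<^sub>Q b) = (\<Sum>b\<in>B. if b = b0 then of_int (d b) else 0)"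
      unfolding MQ_sum[OF f(1)] using f(2) by (intro sum.cong) auto
    then show ?thesis using B b0 by simp
  qed
  show thesis
  proof (rule that[of "\<lambda>x. of_int (sgn (c b0)) * f x"])
    show "(\<lambda>x. of_int (sgn (c b0)) * f x) \<in> MQ" by (rule MQ_scaled[OF f(1)])
    show "of_int (sgn (c b0)) * f x \<in> \<int>" if "x \<in> N" for x
      using that coord by (auto simp: N)
    have "of_int (sgn (c b0)) * f v = of_int \<bar>c b0\<bar>"
      by (simp only: c coord flip: of_int_mult) (simp add: abs_sgn mult.commute)
    then show "0 < of_int (sgn (c b0)) * f v" using b0 by simp
  qed
qed

lemma subgrp_Int: "subgrp H \<Longrightarrow> subgrp K \<Longrightarrow> subgrp (H \<inter> K)"
  by (auto simp: subgrp_def)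

lemma cone_lattice_zero: "0 \<in> N \<Longrightarrow> cone_lattice N {0} = {0}"
  unfolding cone_lattice_def by (intro hull_unique) (auto simp: subgrp_def)

lemma cone_lattice_base: "\<sigma> \<inter> N \<subseteq> cone_lattice N \<sigma>"
  unfolding cone_lattice_def by (rule hull_subset)

lemma cone_lattice_subset: "subgrp N \<Longrightarrow> cone_lattice N \<sigma> \<subseteq> N \<inter> qvec.span \<sigma>"
  unfolding cone_lattice_def
  by (rule hull_minimal)
    (auto intro!: subgrp_Int qvec.span_base simp: subgrp_def[of "qvec.span \<sigma>"]
      qvec.span_zero qvec.span_diff)

text \<open>The normal generator is the shortest nonzero lattice point of the ray, measured by an
  integral form. Since the lattice of the zero cone is trivial, its coset is a singleton. For the
  sign and vanishing of a pairing it is enough to know that this point is a positive multiple of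
  \<open>v\<close>.\<close>

lemma normal_gen_ray:
  assumes lattice: "free_lattice N n" and v: "v \<in> N" "v \<noteq> 0"
  obtains a where "0 < a" "normal_gen N {a *\<^sub>Q v | a. 0 \<le> a} {0} = {a *\<^sub>Q v}"
proof -
  define \<rho> where "\<rho> = {a *\<^sub>Q v | a. 0 \<le> a}"
  have N: "subgrp N" using lattice by (rule free_lattice_subgrp)
  then have zero: "cone_lattice N {0} = {0}" by (simp add: cone_lattice_zero subgrp_def)
  have vrho: "v \<in> \<rho>" unfolding \<rho>_def by (intro CollectI exI[of _ 1]) simp
  obtain \<phi> where \<phi>: "\<phi> \<in> MQ" "\<And>x. x \<in> N \<Longrightarrow> \<phi> x \<in> \<int>" "0 < \<phi> v"
    using free_lattice_integral_form[OF lattice v] by blast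
  have inj: "x = 0" if "x \<in> qvec.span {v}" "\<phi> x = 0" for x
    using that \<phi> by (auto simp: qvec.span_singleton MQ_scale)
  have ray: "x \<in> \<rho>" if "x \<in> qvec.span {v}" "0 \<le> \<phi> x" for x
    using that \<phi> by (auto simp: qvec.span_singleton MQ_scale \<rho>_def zero_le_mult_iff)
  have "qvec.span \<rho> \<subseteq> qvec.span {v}"
    unfolding \<rho>_def
    by (rule qvec.span_minimal[OF _ qvec.subspace_span]) (auto simp: qvec.span_singleton)
  then have cl: "y \<in> N" "y \<in> qvec.span {v}" if "y \<in> cone_lattice N \<rho>" for y
    using that cone_lattice_subset[OF N, of \<rho>] by auto
  have span: "y \<in> qvec.span {v}" if "y \<in> \<rho>" for y
    using that by (auto simp: \<rho>_def qvec.span_singleton)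
  have pos: "0 < \<phi> y" if "y \<in> \<rho>" "y \<noteq> 0" for y
    using that \<phi> by (auto simp: \<rho>_def MQ_scale less_le)
  define P where "P x \<longleftrightarrow> x \<in> \<rho> \<inter> N \<and> x \<noteq> 0" for x
  have "P v" using v vrho by (simp add: P_def)
  \<comment> \<open>The form is rational-valued, so minimality is stated through \<open>nat\<close>
    of the floor. On nonzero lattice points of the ray its values are positive integers, and nothing
    is lost.\<close>
  then obtain x where x: "P x" "\<And>y. P y \<Longrightarrow> nat \<lfloor>\<phi> x\<rfloor> \<le> nat \<lfloor>\<phi> y\<rfloor>"
    using ex_has_least_nat[of P v "\<lambda>x. nat \<lfloor>\<phi> x\<rfloor>"] by blast
  have xpos: "0 < \<phi> x" and xN: "x \<in> N" and xrho: "x \<in> \<rho>"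
    using pos x(1) by (auto simp: P_def)
  have least: "\<phi> x \<le> \<phi> y" if "P y" for y
  proof -
    have y: "y \<in> N" "0 < \<phi> y" using that pos by (auto simp: P_def)
    obtain i j where "\<phi> x = of_int i" "\<phi> y = of_int j"
      using \<phi>(2)[OF xN] \<phi>(2)[OF y(1)] by (auto elim!: Ints_cases)
    then show ?thesis using x(2)[OF that] xpos y by simp
  qed
  have gen: "\<exists>k::int. y = of_int k *\<^sub>Q x" if "y \<in> cone_lattice N \<rho>" for y
  proof -
    \<comment> \<open>Division with remainder: the remainder \<open>r\<close> is a lattice point of
      the ray shorter than \<open>x\<close>, hence zero.\<close>
    define k where "k = \<lfloor>\<phi> y / \<phi> x\<rfloor>"
    define r where "r = y - of_int k *\<^sub>Q x"
    have "of_int k \<le> \<phi> y / \<phi> x" "\<phi> y / \<phi> x < of_int k + 1"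
      unfolding k_def by linarith+
    then have r: "0 \<le> \<phi> r" "\<phi> r < \<phi> x"
      using xpos \<phi>(1) by (simp_all add: r_def MQ_minus MQ_scale field_simps)
    have "r \<in> N" using cl[OF that] xN N by (auto simp: r_def intro!: subgrp_minus subgrp_int_scale)
    moreover have "r \<in> qvec.span {v}" unfolding r_def
      using cl[OF that] span[OF xrho] by (intro qvec.span_diff qvec.span_scale)
    ultimately have "r = 0"
      using least[of r] r ray by (force simp: P_def)
    then show ?thesis by (auto simp: r_def)
  qed
  have "normal_gen N \<rho> {0} = {x}"
    unfolding normal_gen_def zero
  proof (rule the_equality)
    show "\<exists>z\<in>\<rho> \<inter> N. {x} = coset {0} z \<and>
        (\<forall>y\<in>cone_lattice N \<rho>. \<exists>k::int. y - of_int k *\<^sub>Q z \<in> {0})"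
      using x(1) gen by (intro bexI[of _ x]) (auto simp: P_def coset_def)
  next
    fix C assume "\<exists>z\<in>\<rho> \<inter> N. C = coset {0} z \<and>
        (\<forall>y\<in>cone_lattice N \<rho>. \<exists>k::int. y - of_int k *\<^sub>Q z \<in> {0})"
    then obtain z where z: "z \<in> \<rho>" "z \<in> N" "C = {z}"
        and gen_z: "\<forall>y\<in>cone_lattice N \<rho>. \<exists>k::int. y = of_int k *\<^sub>Q z"
      by (auto simp: coset_def)
    obtain k :: int where k: "x = of_int k *\<^sub>Q z"
      using gen_z cone_lattice_base[of \<rho> N] xN xrho by blast
    obtain l :: int where l: "z = of_int l *\<^sub>Q x"
      using gen cone_lattice_base[of \<rho> N] z by blast
    have "z \<noteq> 0" using k x(1) by (auto simp: P_def)
    then have zpos: "0 < \<phi> z" using pos z by blast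
    have eqs: "\<phi> x = of_int k * \<phi> z" "\<phi> z = of_int l * \<phi> x"
      using \<phi>(1) by (subst k, simp add: MQ_scale, subst l, simp add: MQ_scale)
    \<comment> \<open>Two generators are integer multiples of each other, so the factors are
      mutually inverse integers; positivity on the ray excludes -1.\<close>
    have "\<phi> x * 1 = \<phi> x * of_int (k * l)" using eqs by (simp add: mult_ac)
    then have "k * l = 1" using xpos by (metis mult_cancel_left less_irrefl of_int_eq_1_iff)
    moreover have "0 < k" using eqs(1) xpos zpos by (simp add: zero_less_mult_iff)
    ultimately have "k = 1" by (simp add: pos_zmult_eq_1_iff)
    then show "C = {x}" using k z by simp
  qed
  moreover obtain a where "x = a *\<^sub>Q v" "0 \<le> a" using xrho by (auto simp: \<rho>_def)
  ultimately show thesis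
    using that[of a] x(1) by (cases "a = 0") (auto simp: \<rho>_def P_def)
qed

section \<open>Local equations\<close>

lemma MQ_diff: "u \<in> MQ \<Longrightarrow> v \<in> MQ \<Longrightarrow> u - v \<in> MQ"
  unfolding MQ_linear fun_diff_def by (rule qform.linear_compose_sub)

lemma perp_zero [simp]: "0 \<in> perp \<sigma>"
  using zero_in_MQ by (auto simp: perp_def zero_fun_def)

lemma perp_diff: "u \<in> perp \<sigma> \<Longrightarrow> v \<in> perp \<sigma> \<Longrightarrow> u - v \<in> perp \<sigma>"
  by (auto simp: perp_def MQ_diff)

lemma perp_add: "u \<in> perp \<sigma> \<Longrightarrow> v \<in> perp \<sigma> \<Longrightarrow> u + v \<in> perp \<sigma>"
  by (auto simp: perp_def plus_fun_def MQ_add)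

lemma in_coset_perp: "m \<in> coset (perp \<sigma>) m"
  unfolding coset_def by (intro CollectI exI[of _ 0]) simp

lemma coset_perp: "m \<in> perp \<sigma> \<Longrightarrow> coset (perp \<sigma>) m = perp \<sigma>"
  unfolding coset_def
  by (auto simp: perp_add intro!: exI[of _ "_ - m"] perp_diff)

lemma q_cartier_coset:
  assumes "D \<in> q_cartier \<Delta>" "\<sigma> \<in> \<Delta>"
  obtains m where "m \<in> MQ" "D \<sigma> = coset (perp \<sigma>) m"
proof -
  have "D \<sigma> \<in> quot MQ (perp \<sigma>)" using assms by (auto simp: q_cartier_def)
  with that show thesis by (auto simp: quot_def)
qed

text \<open>The image of a coset under \<open>quot_map\<close> is a union of larger cosets and so
  contains every original representative. One form can thus serve as local equation at a cone and at
  all its faces.\<close>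

lemma q_cartier_face:
  assumes "D \<in> q_cartier \<Delta>" "\<sigma> \<in> \<Delta>" "\<tau> \<in> \<Delta>" "face \<tau> \<sigma>" "m \<in> D \<sigma>"
  shows "m \<in> D \<tau>"
proof (cases "\<tau> = \<sigma>")
  case False
  then have "quot_map (perp \<tau>) (D \<sigma>) = D \<tau>"
    using assms by (auto simp: q_cartier_def proper_face_def)
  with assms(5) in_coset_perp show ?thesis by (auto simp: quot_map_def)
qed (use assms in simp)

text \<open>Representatives differ by forms vanishing on \<sigma>, so they share one value at
  \<open>x\<close>. This makes the definite description in \<open>pairing\<close> well
  defined.\<close>

lemma pairing_singleton:
  assumes "x \<in> \<sigma>" "l \<in> coset (perp \<sigma>) m"
  shows "pairing (coset (perp \<sigma>) m) {x} = l x"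
proof -
  have val: "k x = m x" if k: "k \<in> coset (perp \<sigma>) m" for k
  proof -
    obtain w where w: "k = m + w" "w \<in> perp \<sigma>" using k by (auto simp: coset_def)
    have "w x = 0" using w(2) assms(1) unfolding perp_def by blast
    with w(1) show ?thesis by simp
  qed
  show ?thesis
    unfolding pairing_def
  proof (rule the_equality)
    show "\<forall>k\<in>coset (perp \<sigma>) m. \<forall>y\<in>{x}. k y = l x"
    proof (intro ballI)
      fix k y assume "k \<in> coset (perp \<sigma>) m" "y \<in> {x}"
      then show "k y = l x" using val[of k] val[OF assms(2)] by simp
    qed
  next
    fix r assume "\<forall>k\<in>coset (perp \<sigma>) m. \<forall>y\<in>{x}. k y = r"
    then have "l x = r" using assms(2) by blast
    then show "r = l x" by simp
  qed
qed

lemma facet_zero_ray: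
  assumes "v \<noteq> 0"
  shows "facet {0} {a *\<^sub>Q v | a. 0 \<le> a}"
proof -
  \<comment> \<open>The span of the empty set is zero, so a nonzero \<open>v\<close> is separated
    from it; this form exhibits the apex as a face of the ray.\<close>
  obtain u where u: "u \<in> MQ" "u v = 1"
    using form_separating_point[of v "{}"] assms by auto
  have "qvec.dim {0 :: 'a} = 0"
    by (rule qvec.dim_unique[of "{}"]) (auto simp: qvec.independent_empty)
  moreover have "face {0} {a *\<^sub>Q v | a. 0 \<le> a}"
    unfolding face_def using u by (intro bexI[of _ u]) (auto simp: MQ_scale intro!: exI[of _ 0])
  ultimately show ?thesis using dim_ray[OF assms] by (simp add: facet_def)
qed

text \<open>Different cones are different basis elements, so only the summand at \<rho> contributes.
  Finiteness of the fan keeps the sum from taking its default value 0.\<close>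

lemma lookup_cycle_on:
  assumes "finite \<Delta>" "\<rho> \<in> \<Delta>" "facet \<sigma> \<rho>"
  shows "Poly_Mapping.lookup (cycle_on N \<Delta> \<sigma> E) \<rho> = pairing (E \<rho>) (normal_gen N \<rho> \<sigma>)"
  using assms by (simp add: cycle_on_def lookup_sum lookup_single when_def)

text \<open>The coset \<open>perp \<sigma>\<close> is the zero class of the quotient, so this is the
  passage from the condition on coefficients to a vanishing local equation.\<close>

lemma local_equation_trivial:
  assumes lattice: "free_lattice N n" and fan: "fan N \<Delta>" and D: "D \<in> q_cartier \<Delta>"
    and \<sigma>: "\<sigma> \<in> \<Delta>" and proper: "meets_properly N \<Delta> D \<sigma>"
  shows "D \<sigma> = perp \<sigma>"
proof -
  obtain m where m: "m \<in> MQ" "D \<sigma> = coset (perp \<sigma>) m"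
    using q_cartier_coset[OF D \<sigma>] by blast
  have "rational_polyhedral_cone N \<sigma>" and sc: "strongly_convex \<sigma>" and fin: "finite \<Delta>"
    using fan \<sigma> by (auto simp: fan_def)
  then obtain S where S: "finite S" "S \<subseteq> N" "\<sigma> = cone_hull S"
      "\<And>v. v \<in> S \<Longrightarrow> v \<notin> cone_hull (S - {v})"
    using minimal_generators by blast
  have "m v = 0" if "v \<in> S" for v
  proof -
    define \<rho> where "\<rho> = {a *\<^sub>Q v | a. 0 \<le> a}"
    have v: "v \<noteq> 0" and face: "face \<rho> \<sigma>"
      using face_minimal_generator[OF S(1) _ S(4) that] sc S(3) by (auto simp: \<rho>_def)
    have \<rho>: "\<rho> \<in> \<Delta>" using fan \<sigma> face by (auto simp: fan_def)
    have "v \<in> N" using that S(2) by blast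
    then obtain a where a: "0 < a" "normal_gen N \<rho> {0} = {a *\<^sub>Q v}"
      unfolding \<rho>_def using normal_gen_ray[OF lattice _ v] by blast
    have av: "a *\<^sub>Q v \<in> \<rho>" using a(1) by (auto simp: \<rho>_def)
    have "m \<in> D \<rho>" using q_cartier_face[OF D \<sigma> \<rho> face] m in_coset_perp by blast
    moreover obtain l where "D \<rho> = coset (perp \<rho>) l" using q_cartier_coset[OF D \<rho>] by blast
    \<comment> \<open>The coefficient of the divisor along the ray is the value of \<open>m\<close>
      at a positive multiple of \<open>v\<close>; proper intersection makes it zero.\<close>
    ultimately have "pairing (D \<rho>) {a *\<^sub>Q v} = m (a *\<^sub>Q v)"
      using pairing_singleton[OF av, of m l] by simp
    moreover have "pairing (D \<rho>) {a *\<^sub>Q v} = 0"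
      using proper \<rho> face lookup_cycle_on[OF fin \<rho>, of "{0}" N D] facet_zero_ray[OF v] dim_ray[OF v] a(2)
      by (simp add: meets_properly_def \<rho>_def)
    ultimately show "m v = 0" using a(1) m(1) by (simp add: MQ_scale)
  qed
  then have "m \<in> perp \<sigma>"
    using m(1) by (auto simp: perp_def S(3) cone_hull_def MQ_sum)
  then show ?thesis using m(2) by (simp add: coset_perp)
qed

text \<open>\<open>m\<close> itself is a candidate for its projection, and any other candidate
  differs from it by an element of both the complement and \<open>perp \<sigma>\<close>.\<close>

lemma proj_perp:
  assumes "complements \<Delta> \<Psi>" "\<sigma> \<in> \<Delta>" "m \<in> perp \<sigma>"
  shows "proj \<Psi> \<sigma> m = m"
  unfolding proj_def
proof (rule the_equality)
  have \<Psi>: "\<Psi> \<sigma> \<inter> perp \<sigma> = {0}" using assms by (auto simp: complements_def)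
  then show "m \<in> perp \<sigma> \<and> m - m \<in> \<Psi> \<sigma>" using assms(3) by auto
  fix p assume "p \<in> perp \<sigma> \<and> m - p \<in> \<Psi> \<sigma>"
  then have "m - p \<in> \<Psi> \<sigma> \<inter> perp \<sigma>" using assms(3) perp_diff by blast
  then show "p = m" by (simp add: \<Psi>)
qed

theorem proposition4p1:
  fixes N :: "'v::rat_vector set" and n :: nat and \<Delta> :: "'v set set"
    and \<Psi> D :: "'v set \<Rightarrow> ('v \<Rightarrow> rat) set" and \<sigma> :: "'v set"
  assumes "free_lattice N n"
    and "fan N \<Delta>"
    and "complements \<Delta> \<Psi>"
    and "D \<in> q_cartier \<Delta>"
    and "\<sigma> \<in> \<Delta>"
    and "meets_properly N \<Delta> D \<sigma>"
  shows "restriction \<Delta> D \<sigma> \<in> q_cartier_on \<Delta> \<sigma> \<and>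
    proj_divisor \<Delta> \<Psi> D \<sigma> = restriction \<Delta> D \<sigma> \<and>
    intersect N \<Delta> \<Psi> D \<sigma> = cycle_on N \<Delta> \<sigma> (restriction \<Delta> D \<sigma>)"
proof -
  have triv: "D \<sigma> = perp \<sigma>"
    using assms by (intro local_equation_trivial)
  \<comment> \<open>A representative at \<tau> also represents the class at the face \<sigma>, which
    is the zero class.\<close>
  have sub: "D \<tau> \<subseteq> perp \<sigma>" if "\<tau> \<in> star \<Delta> \<sigma>" for \<tau>
    using that q_cartier_face[OF assms(4) _ assms(5)] triv by (auto simp: star_def)
  \<comment> \<open>Consequently, intersecting with \<open>perp \<sigma>\<close> removes nothing,
    and compatibility on the star is inherited from \<open>D\<close>.\<close>
  have restr: "restriction \<Delta> D \<sigma> = restrict D (star \<Delta> \<sigma>)"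
    unfolding restriction_def using sub by (intro restrict_ext) blast
  have "D \<tau> \<in> quot (perp \<sigma>) (perp \<tau>)" if "\<tau> \<in> star \<Delta> \<sigma>" for \<tau>
  proof -
    have \<tau>: "\<tau> \<in> \<Delta>" using that by (simp add: star_def)
    obtain m where m: "D \<tau> = coset (perp \<tau>) m"
      using q_cartier_coset[OF assms(4) \<tau>] by blast
    then have "m \<in> perp \<sigma>" using sub[OF that] in_coset_perp by blast
    with m show ?thesis by (auto simp: quot_def)
  qed
  then have "restriction \<Delta> D \<sigma> \<in> q_cartier_on \<Delta> \<sigma>"
    using assms(4) by (auto simp: restr q_cartier_on_def q_cartier_def star_def)
  moreover have "proj_divisor \<Delta> \<Psi> D \<sigma> = restriction \<Delta> D \<sigma>"
    unfolding restr proj_divisor_def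
  proof (rule restrict_ext)
    fix \<tau> assume "\<tau> \<in> star \<Delta> \<sigma>"
    then have "proj \<Psi> \<sigma> m = m" if "m \<in> D \<tau>" for m
      using sub that proj_perp[OF assms(3,5)] by blast
    then show "proj \<Psi> \<sigma> ` D \<tau> = D \<tau>" by simp
  qed
  ultimately show ?thesis by (simp add: intersect_def)
qed

end
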